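(* Let $V\subseteq L^p(\mathbb{R}^n)$ be the range of an idempotent integral operator $T$ with kernel $K$ satisfying the standing assumptions listed in the context. Let $R>0$, let $\delta$ be a real number, and put $$V^{\star}(R,\delta)=\Big\{f\in V : (1-\delta)\|f\|_{L^p(\mathbb{R}^n)}^p\leq \int_{C_R} |f(x)|^p\, dx \Big\},\qquad C_R=\left[-\tfrac{R}{2},\tfrac{R}{2}\right]^n .$$ Assume that $\{x_j : j\in \mathbb{N}\}$ is a sequence of i.i.d. random variables uniformly distributed over the cube $C_R$ and that $0<\mu<1-\delta$. Then there exist $a,b>0$ such that, for every integer $r\ge 1$, the sampling inequality $$\frac{r}{R^n}(1-\mu-\delta)\|f\|_{L^p(\mathbb{R}^n)}^p\leq \sum_{j=1}^{r} |f(x_j)|^p \leq \frac{r}{R^n}(1+\mu)\|f\|_{L^p(\mathbb{R}^n)}^p$$ holds simultaneously for every $f\in V^{\star}(R,\delta)$ with probability at least $$1-2a\exp\left( -\frac{b}{p\,k^{p-1}R^n}\, \frac{r\mu^2}{12+\mu} \right),\qquad\text{where } k=\sup_{x\in C_R} \|K(x,\cdot)\|_{L^{p'}(\mathbb{R}^n)}.$$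
   Context: Functions are real-valued. Let $n\ge 1$, $1\le p<\infty$, $\frac1p+\frac1{p'}=1$ (with $p'=\infty$ if $p=1$), and $\|x\|_1=\sum_{i=1}^n|x(i)|$ for $x=(x(1),\dots,x(n))\in\mathbb{R}^n$. Standing assumptions: $T:L^p(\mathbb{R}^n)\to L^p(\mathbb{R}^n)$, $Tf(x)=\int_{\mathbb{R}^n}K(x,y)f(y)\,dy$, is an integral operator with $T^2=T$, whose (measurable) kernel $K$ is symmetric, $K(x,y)=K(y,x)$, and satisfies: (1) regularity: $\lim_{\varepsilon\to 0}\big\|\sup_{z\in\mathbb{R}^n}|osc_\varepsilon(K)(\cdot+z,z)|\big\|_{L^1(\mathbb{R}^n)}=0$, where $osc_\varepsilon(K)(x,y)=\sup_{x',y'\in[-\varepsilon,\varepsilon]^n}|K(x+x',y+y')-K(x,y)|$; (2) decay: $|K(x,y)|\le \dfrac{C}{(1+\|x-y\|_1)^\alpha}$ for all $x,y\in\mathbb{R}^n$, with constants $C>0$ and $\alpha>\frac{n}{p'}+n+1$ (where $n/p'=0$ if $p'=\infty$). $V$ denotes the range of $T$; it is a closed reproducing kernel subspace of $L^p(\mathbb{R}^n)$. Each $f\in V$ is identified with its pointwise-defined representative $f(x)=\int_{\mathbb{R}^n}K(x,y)f(y)\,dy$, $x\in\mathbb{R}^n$. *)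

theory Defs
  imports "HOL-Probability.Probability"
begin

definition Lp_space :: "real \<Rightarrow> ('a::euclidean_space \<Rightarrow> real) set" where
  "Lp_space p = {f \<in> borel_measurable lebesgue. integrable lebesgue (\<lambda>x. \<bar>f x\<bar> powr p)}"

text \<open>The $L^q$ norm for $1 \le q \le \infty$; it is meaningful only for functions that
  belong to $L^q$, since both \<^const>\<open>enn2real\<close> and the Bochner integral send infinite
  values to 0.\<close>

definition Lp_norm :: "ennreal \<Rightarrow> ('a::euclidean_space \<Rightarrow> real) \<Rightarrow> real" where
  "Lp_norm q f =
    (if q = \<infinity> then enn2real (esssup lebesgue (\<lambda>x. ennreal \<bar>f x\<bar>))
     else (LINT x|lebesgue. \<bar>f x\<bar> powr enn2real q) powr (1 / enn2real q))"

definition conj_exponent :: "real \<Rightarrow> ennreal" where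
  "conj_exponent p = (if p = 1 then \<infinity> else ennreal (p / (p - 1)))"

definition l1_norm :: "real ^ 'n \<Rightarrow> real" where
  "l1_norm x = (\<Sum>i\<in>UNIV. \<bar>x $ i\<bar>)"

text \<open>The cube $[-s,s]^n$; in particular $C_R$ is \<open>cube (R / 2)\<close>.\<close>

definition cube :: "real \<Rightarrow> (real ^ 'n) set" where
  "cube s = cbox (vec (- s)) (vec s)"

definition osc :: "real \<Rightarrow> (real ^ 'n \<Rightarrow> real ^ 'n \<Rightarrow> real) \<Rightarrow> real ^ 'n \<Rightarrow> real ^ 'n \<Rightarrow> ennreal" where
  "osc \<epsilon> K x y = (SUP x'\<in>cube \<epsilon>. SUP y'\<in>cube \<epsilon>. ennreal \<bar>K (x + x') (y + y') - K x y\<bar>)"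

text \<open>The nonnegative integral of a function is the supremum of the integrals of the
  simple functions below it, so measurability of the supremum over \<open>z\<close> is not
  presupposed here.\<close>

definition kernel_regular :: "(real ^ 'n \<Rightarrow> real ^ 'n \<Rightarrow> real) \<Rightarrow> bool" where
  "kernel_regular K \<longleftrightarrow>
    ((\<lambda>\<epsilon>. \<integral>\<^sup>+ x. (SUP z. osc \<epsilon> K (x + z) z) \<partial>lebesgue) \<longlongrightarrow> 0) (at_right 0)"

definition kernel_decay :: "real \<Rightarrow> real \<Rightarrow> (real ^ 'n \<Rightarrow> real ^ 'n \<Rightarrow> real) \<Rightarrow> bool" where
  "kernel_decay C \<alpha> K \<longleftrightarrow> (\<forall>x y. \<bar>K x y\<bar> \<le> C / (1 + l1_norm (x - y)) powr \<alpha>)"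

definition kernel_op :: "(real ^ 'n \<Rightarrow> real ^ 'n \<Rightarrow> real) \<Rightarrow> (real ^ 'n \<Rightarrow> real) \<Rightarrow> real ^ 'n \<Rightarrow> real" where
  "kernel_op K f x = (LINT y|lebesgue. K x y * f y)"

text \<open>$T$ maps $L^p$ to $L^p$ and $T^2 = T$, as an identity between classes of functions
  modulo null sets.\<close>

definition idempotent_on_Lp :: "real \<Rightarrow> (real ^ 'n \<Rightarrow> real ^ 'n \<Rightarrow> real) \<Rightarrow> bool" where
  "idempotent_on_Lp p K \<longleftrightarrow>
    (\<forall>f\<in>Lp_space p. kernel_op K f \<in> Lp_space p \<and>
      (AE x in lebesgue. kernel_op K (kernel_op K f) x = kernel_op K f x))"

text \<open>Elements of the range $V$ of $T$ are classes modulo null sets; each of them is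
  represented here by its one function with $f(x) = \int K(x,y) f(y)\,dy$ for every $x$.\<close>

definition op_range :: "real \<Rightarrow> (real ^ 'n \<Rightarrow> real ^ 'n \<Rightarrow> real) \<Rightarrow> (real ^ 'n \<Rightarrow> real) set" where
  "op_range p K = {f \<in> Lp_space p.
     (\<exists>g\<in>Lp_space p. AE x in lebesgue. f x = kernel_op K g x) \<and> (\<forall>x. f x = kernel_op K f x)}"

definition V_star ::
  "real \<Rightarrow> (real ^ 'n \<Rightarrow> real ^ 'n \<Rightarrow> real) \<Rightarrow> real \<Rightarrow> real \<Rightarrow> (real ^ 'n \<Rightarrow> real) set" where
  "V_star p K R \<delta> = {f \<in> op_range p K.
     (1 - \<delta>) * Lp_norm (ennreal p) f powr p \<le> (LINT x:cube (R / 2)|lebesgue. \<bar>f x\<bar> powr p)}"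

definition kernel_sup :: "real \<Rightarrow> (real ^ 'n \<Rightarrow> real ^ 'n \<Rightarrow> real) \<Rightarrow> real \<Rightarrow> real" where
  "kernel_sup p K R = (SUP x\<in>cube (R / 2). Lp_norm (conj_exponent p) (K x))"

text \<open>$k^{p-1}$, with $k^0 = 1$ also for $k = 0$, where \<open>0 powr 0 = 0\<close>.\<close>

definition kernel_sup_pow :: "real \<Rightarrow> (real ^ 'n \<Rightarrow> real ^ 'n \<Rightarrow> real) \<Rightarrow> real \<Rightarrow> real" where
  "kernel_sup_pow p K R = (if p = 1 then 1 else kernel_sup p K R powr (p - 1))"

end

theory Submission
  imports Defs
begin

text \<open>As \<open>a\<close> and \<open>b\<close> may depend on \<open>\<mu>\<close>, only an exponential decay in \<open>r\<close> of the failure probability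
  has to be shown. By regularity of the kernel, functions with \<open>f = Tf\<close> and \<open>\<parallel>f\<parallel>\<^sub>p \<le> 1\<close> are uniformly
  bounded and equicontinuous, so the functions \<open>|f|\<^sup>p\<close> have a finite net in the sup norm on the cube.
  Hoeffding's inequality and a union bound over the net control the deviation of the empirical means
  of all these \<open>|f|\<^sup>p\<close> at once; the general case follows by homogeneity. The event is measurable,
  although it is an uncountable intersection, because it is the preimage of a closed set of sample
  sequences.\<close>

section \<open>Functions reproduced by a regular kernel\<close>

lemma mem_cube: "y \<in> cube s \<longleftrightarrow> (\<forall>i. \<bar>y $ i\<bar> \<le> s)"
  by (auto simp: cube_def mem_box_cart abs_le_iff) (metis minus_le_iff)+

lemma compact_cube: "compact (cube s)"
  by (simp add: cube_def)

lemma emeasure_cube: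
  assumes "0 \<le> s"
  shows "emeasure lborel (cube s :: (real^'n) set) = ennreal ((2 * s) ^ CARD('n))"
proof -
  have ne: "cube s \<noteq> ({} :: (real^'n) set)"
    using assms by (auto simp: mem_cube set_eq_iff intro!: exI[of _ 0])
  have "measure lborel (cube s :: (real^'n) set) = (\<Prod>i\<in>(UNIV::'n set). s - (- s))"
    using ne unfolding cube_def by (subst content_cbox_cart) auto
  also have "\<dots> = (2 * s) ^ CARD('n)"
    by simp
  finally have "measure lborel (cube s :: (real^'n) set) = (2 * s) ^ CARD('n)" .
  moreover have "emeasure lborel (cube s :: (real^'n) set) \<noteq> \<infinity>"
    unfolding cube_def using emeasure_lborel_cbox_finite by (metis less_irrefl)
  ultimately show ?thesis
    by (metis emeasure_eq_ennreal_measure infinity_ennreal_def)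
qed

text \<open>The map y to x - y is affine with linear part -1, so its Jacobian factor is 1. This
  turns kernel bounds that depend on x - y into integrals independent of x.\<close>

lemma nn_integral_reflect_lborel:
  fixes x :: "'a::euclidean_space"
  assumes [measurable]: "H \<in> borel_measurable borel"
  shows "(\<integral>\<^sup>+ y. H (x - y) \<partial>lborel) = (\<integral>\<^sup>+ y. H y \<partial>lborel)"
proof -
  have L: "lborel = density (distr lborel borel (\<lambda>y. x + (- 1) *\<^sub>R y)) (\<lambda>_. ennreal (\<bar>- 1\<bar> ^ DIM('a)))"
    by (rule lborel_affine) simp
  have "(\<integral>\<^sup>+ y. H y \<partial>lborel) = (\<integral>\<^sup>+ y. H y \<partial>density (distr lborel borel (\<lambda>y. x + (- 1) *\<^sub>R y)) (\<lambda>_. ennreal (\<bar>- 1\<bar> ^ DIM('a))))"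
    by (simp only: L[symmetric])
  also have "\<dots> = (\<integral>\<^sup>+ y. H (x - y) \<partial>lborel)"
    by (subst nn_integral_density) (auto simp: nn_integral_distr)
  finally show ?thesis by simp
qed

lemma l1_norm_nonneg: "0 \<le> l1_norm x"
  by (simp add: l1_norm_def sum_nonneg)

lemma component_le_l1_norm: "\<bar>x $ i\<bar> \<le> l1_norm x"
  unfolding l1_norm_def by (rule member_le_sum) auto

lemma borel_measurable_l1_norm [measurable]: "l1_norm \<in> borel_measurable borel"
  unfolding l1_norm_def[abs_def] by (intro borel_measurable_continuous_onI continuous_intros)

text \<open>Decompose the space by the integer part m of the l1 norm. The layer of m lies in
  \<open>cube (Suc m)\<close>, of volume (2(m+1))^n, and the weight there is at most C
  (m+1)^(-\<alpha>). The resulting series has terms C 2^n (m+1)^(n-\<alpha>) and converges because n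
  - \<alpha> < -1.\<close>

lemma decay_integral_finite:
  assumes "\<alpha> > real CARD('n) + 1" and "C > 0"
  shows "(\<integral>\<^sup>+ y. ennreal (C / (1 + l1_norm (y :: real^'n)) powr \<alpha>) \<partial>lborel) < \<infinity>"
proof -
  let ?n = "CARD('n)"
  have pt: "ennreal (C / (1 + l1_norm y) powr \<alpha>)
      \<le> (\<Sum>m. ennreal (C * real (Suc m) powr (- \<alpha>)) * indicator (cube (real (Suc m))) y)"
    for y :: "real^'n"
  proof -
    define F :: "nat \<Rightarrow> ennreal" where
      "F = (\<lambda>m. ennreal (C * real (Suc m) powr (- \<alpha>)) * indicator (cube (real (Suc m))) y)"
    define m where "m = nat \<lfloor>l1_norm y\<rfloor>"
    have m: "real m \<le> l1_norm y" "l1_norm y \<le> real (Suc m)"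
      using l1_norm_nonneg[of y] unfolding m_def by linarith+
    have "(1 + l1_norm y) powr (- \<alpha>) \<le> real (Suc m) powr (- \<alpha>)"
      using m assms by (intro powr_mono2') auto
    then have "ennreal (C / (1 + l1_norm y) powr \<alpha>) \<le> ennreal (C * real (Suc m) powr (- \<alpha>))"
      using assms(2) by (intro ennreal_leI) (simp add: powr_minus divide_inverse)
    also have "\<dots> = ennreal (C * real (Suc m) powr (- \<alpha>)) * indicator (cube (real (Suc m))) y"
      using order_trans[OF component_le_l1_norm m(2)] by (simp add: mem_cube)
    also have "\<dots> = F m"
      by (simp only: F_def)
    also have "\<dots> \<le> suminf F"
      using sum_le_suminf[of F "{m}"] by simp
    finally show ?thesis by (simp only: F_def)
  qed
  have [measurable]: "cube s \<in> sets (borel :: (real^'n) measure)" for s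
    by (simp add: cube_def)
  have "(\<integral>\<^sup>+ y. ennreal (C / (1 + l1_norm (y :: real^'n)) powr \<alpha>) \<partial>lborel)
      \<le> (\<integral>\<^sup>+ y. (\<Sum>m. ennreal (C * real (Suc m) powr (- \<alpha>)) * indicator (cube (real (Suc m))) y) \<partial>(lborel :: (real^'n) measure))"
    by (intro nn_integral_mono pt)
  also have "\<dots> = (\<Sum>m. \<integral>\<^sup>+ y. ennreal (C * real (Suc m) powr (- \<alpha>)) * indicator (cube (real (Suc m))) y \<partial>(lborel :: (real^'n) measure))"
    by (intro nn_integral_suminf) measurable
  also have "\<dots> = (\<Sum>m. ennreal (C * real (Suc m) powr (- \<alpha>) * (2 * real (Suc m)) ^ ?n))"
    using assms(2) by (simp add: nn_integral_cmult_indicator emeasure_cube ennreal_mult)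
  also have "\<dots> = (\<Sum>m. ennreal (C * 2 ^ ?n * real (Suc m) powr (real ?n - \<alpha>)))"
    by (intro suminf_cong arg_cong[where f = ennreal])
       (simp add: power_mult_distrib powr_diff powr_minus divide_inverse powr_realpow del: of_nat_Suc)
  also have "\<dots> < \<infinity>"
  proof -
    have "summable (\<lambda>m. real m powr (real ?n - \<alpha>))"
      using assms by (subst summable_real_powr_iff) auto
    then have "summable (\<lambda>m. real (Suc m) powr (real ?n - \<alpha>))"
      by (rule iffD2[OF summable_Suc_iff])
    then have "summable (\<lambda>m. C * 2 ^ ?n * real (Suc m) powr (real ?n - \<alpha>))"
      by (rule summable_mult)
    then show ?thesis
      using assms(2) by (subst suminf_ennreal2) auto
  qed
  finally show ?thesis .
qed

section \<open>Oscillation of the kernel and measurability of its sections\<close>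

lemma le_osc:
  assumes "x' \<in> cube \<epsilon>" "y' \<in> cube \<epsilon>"
  shows "ennreal \<bar>K (x + x') (y + y') - K x y\<bar> \<le> osc \<epsilon> K x y"
  unfolding osc_def
  by (rule SUP_upper2[OF assms(1)], rule SUP_upper2[OF assms(2)]) simp

text \<open>The integrand in \<^const>\<open>kernel_regular\<close> need not be measurable, so its integral is only a
  lower integral. Its supremum over a small open box is lower semicontinuous and is dominated by
  twice the same quantity at the doubled scale.\<close>

lemma kernel_modulus:
  fixes K :: "real ^ 'n \<Rightarrow> real ^ 'n \<Rightarrow> real"
  assumes "kernel_regular K" and "e > 0"
  obtains \<epsilon> H where "\<epsilon> > 0" and "H \<in> borel_measurable borel"
    and "(\<integral>\<^sup>+ y. H y \<partial>lborel) \<le> ennreal e"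
    and "\<And>x x' y. x' - x \<in> cube \<epsilon> \<Longrightarrow> ennreal \<bar>K x' y - K x y\<bar> \<le> H (x - y)"
proof -
  define G where "G \<epsilon> x = (SUP z. osc \<epsilon> K (x + z) z)" for \<epsilon> x
  \<comment> \<open>The target is e/2 because \<open>H\<close> will be dominated by twice
    \<open>G (2 * \<epsilon>)\<close>. With \<epsilon> = b/4 the doubled scale is b/2, still below
    b.\<close>
  have "eventually (\<lambda>\<epsilon>. (\<integral>\<^sup>+ x. G \<epsilon> x \<partial>lebesgue) < ennreal (e / 2)) (at_right 0)"
    using assms unfolding kernel_regular_def G_def by (intro order_tendstoD(2)) auto
  then obtain b where "b > 0" and b: "\<And>\<epsilon>. 0 < \<epsilon> \<Longrightarrow> \<epsilon> < b \<Longrightarrow> (\<integral>\<^sup>+ x. G \<epsilon> x \<partial>lebesgue) < ennreal (e / 2)"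
    unfolding eventually_at_right_field by auto
  define \<epsilon> where "\<epsilon> = b / 4"
  have \<epsilon>: "\<epsilon> > 0" and Gi: "(\<integral>\<^sup>+ x. G (2 * \<epsilon>) x \<partial>lebesgue) < ennreal (e / 2)"
    using \<open>b > 0\<close> by (auto simp: \<epsilon>_def intro!: b)
  define U where "U x = {u :: real^'n. \<forall>i. \<bar>u $ i - x $ i\<bar> < \<epsilon>}" for x
  define H where "H x = (SUP u\<in>U x. G \<epsilon> u)" for x
  have meas: "H \<in> borel_measurable borel"
  proof (rule borel_measurableI_greater)
    fix t
    \<comment> \<open>The relation between x and u in \<open>U x\<close> is symmetric: it says that
      x lies in the open box of half side \<epsilon> about u. Hence the superlevel set is a union of
      open boxes, whatever set the centres u form.\<close>
    have "{x \<in> space borel. t < H x} = (\<Union>u\<in>{u. t < G \<epsilon> u}. box (u - vec \<epsilon>) (u + vec \<epsilon>))"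
      by (auto simp: H_def U_def less_SUP_iff mem_box_cart abs_less_iff algebra_simps; 
          smt (verit, ccfv_SIG))
    also have "\<dots> \<in> sets borel"
      by (intro borel_open open_UN ballI open_box)
    finally show "{x \<in> space borel. t < H x} \<in> sets borel" .
  qed
  have le: "H x \<le> 2 * G (2 * \<epsilon>) x" for x
    unfolding H_def
  proof (rule SUP_least)
    fix u assume u: "u \<in> U x"
    show "G \<epsilon> u \<le> 2 * G (2 * \<epsilon>) x"
      unfolding G_def[of \<epsilon>] osc_def
    proof (intro SUP_least)
      fix z x' y' :: "real^'n" assume x': "x' \<in> cube \<epsilon>" and y': "y' \<in> cube \<epsilon>"
      \<comment> \<open>The value at (x + z, z) serves as intermediate point: both (u + z + x', z +
        y') and (u + z, z) differ from it by at most 2\<epsilon> in each coordinate. The triangle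
        inequality then costs the factor 2.\<close>
      have G: "osc (2 * \<epsilon>) K (x + z) z \<le> G (2 * \<epsilon>) x"
        unfolding G_def by (rule SUP_upper) simp
      have near: "\<bar>u $ i - x $ i\<bar> < \<epsilon>" "\<bar>x' $ i\<bar> \<le> \<epsilon>" "\<bar>y' $ i\<bar> \<le> \<epsilon>" for i
        using u x' y' by (auto simp: U_def mem_cube)
      have c1: "u - x + x' \<in> cube (2 * \<epsilon>)"
        unfolding mem_cube
      proof
        show "\<bar>(u - x + x') $ i\<bar> \<le> 2 * \<epsilon>" for i
          using near(1,2)[of i] by simp
      qed
      have c2: "u - x \<in> cube (2 * \<epsilon>)"
        unfolding mem_cube
      proof
        show "\<bar>(u - x) $ i\<bar> \<le> 2 * \<epsilon>" for i
          using near(1)[of i] \<epsilon> by simp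
      qed
      have c3: "y' \<in> cube (2 * \<epsilon>)"
        unfolding mem_cube
      proof
        show "\<bar>y' $ i\<bar> \<le> 2 * \<epsilon>" for i
          using near(3)[of i] \<epsilon> by simp
      qed
      have c4: "0 \<in> cube (2 * \<epsilon>)"
        using \<epsilon> by (simp add: mem_cube)
      have 1: "ennreal \<bar>K (u + z + x') (z + y') - K (x + z) z\<bar> \<le> G (2 * \<epsilon>) x"
      proof -
        have "x + z + (u - x + x') = u + z + x'" by simp
        then show ?thesis
          using order_trans[OF le_osc[OF c1 c3, of K "x + z" z] G] by (simp only:)
      qed
      have 2: "ennreal \<bar>K (u + z) z - K (x + z) z\<bar> \<le> G (2 * \<epsilon>) x"
      proof -
        have "x + z + (u - x) = u + z" "z + 0 = z" by simp_all
        then show ?thesis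
          using order_trans[OF le_osc[OF c2 c4, of K "x + z" z] G] by (simp only:)
      qed
      have "ennreal \<bar>K (u + z + x') (z + y') - K (u + z) z\<bar>
          \<le> ennreal (\<bar>K (u + z + x') (z + y') - K (x + z) z\<bar> + \<bar>K (u + z) z - K (x + z) z\<bar>)"
        by (intro ennreal_leI) linarith
      also have "\<dots> = ennreal \<bar>K (u + z + x') (z + y') - K (x + z) z\<bar> + ennreal \<bar>K (u + z) z - K (x + z) z\<bar>"
        by (rule ennreal_plus) auto
      also have "\<dots> \<le> G (2 * \<epsilon>) x + G (2 * \<epsilon>) x"
        by (intro add_mono 1 2)
      finally show "ennreal \<bar>K (u + z + x') (z + y') - K (u + z) z\<bar> \<le> 2 * G (2 * \<epsilon>) x"
        by (simp only: mult_2[of "G (2 * \<epsilon>) x"])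
    qed
  qed
  have int: "(\<integral>\<^sup>+ y. H y \<partial>lborel) \<le> ennreal e"
  proof -
    \<comment> \<open>The factor 2 is moved to the side of the measurable function \<open>H\<close>.
      For \<open>G (2 * \<epsilon>)\<close> only monotonicity of the lower integral is used.\<close>
    have half: "H y / 2 \<le> G (2 * \<epsilon>) y" for y
      using le[of y] by (intro divide_le_posI_ennreal) (auto simp: mult.commute)
    have "(\<integral>\<^sup>+ y. H y \<partial>lborel) / 2 = (\<integral>\<^sup>+ y. H y / 2 \<partial>lborel)"
      using meas by (simp add: nn_integral_divide)
    also have "\<dots> \<le> (\<integral>\<^sup>+ y. G (2 * \<epsilon>) y \<partial>lborel)"
      by (intro nn_integral_mono half)
    also have "\<dots> \<le> ennreal (e / 2)"
      using Gi by (simp add: nn_integral_completion)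
    finally have "(\<integral>\<^sup>+ y. H y \<partial>lborel) / 2 * 2 \<le> ennreal (e / 2) * 2"
      by (rule mult_right_mono) simp
    moreover have "ennreal (e / 2) * 2 = ennreal e"
      using assms(2) ennreal_mult[of "e / 2" 2] by simp
    ultimately show ?thesis
      by (simp add: ennreal_divide_times)
  qed
  show ?thesis
  proof (rule that[OF \<epsilon> meas int])
    fix x x' y :: "real^'n" assume x': "x' - x \<in> cube \<epsilon>"
    \<comment> \<open>Only the first variable is shifted, by x' - x, while the second shift is 0.
      Taking z = y in the supremum leaves a bound that depends on x - y alone.\<close>
    have "ennreal \<bar>K x' y - K x y\<bar> \<le> osc \<epsilon> K ((x - y) + y) y"
      using le_osc[OF x', of 0 K x y] \<epsilon> by (auto simp: mem_cube)
    also have "\<dots> \<le> G \<epsilon> (x - y)"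
      unfolding G_def by (rule SUP_upper) simp
    also have "\<dots> \<le> H (x - y)"
      unfolding H_def using \<epsilon> by (intro SUP_upper) (auto simp: U_def)
    finally show "ennreal \<bar>K x' y - K x y\<bar> \<le> H (x - y)" .
  qed
qed

text \<open>Joint measurability only gives this for almost every \<open>x\<close>; by regularity every section is an
  almost everywhere limit of such sections.\<close>

lemma kernel_section_measurable:
  fixes K :: "real ^ 'n \<Rightarrow> real ^ 'n \<Rightarrow> real"
  assumes K: "(\<lambda>(x, y). K x y) \<in> borel_measurable lebesgue" and reg: "kernel_regular K"
  shows "K x \<in> borel_measurable lebesgue"
proof -
  \<comment> \<open>The sections of a Borel version \<open>g\<close> are Borel. By Fubini, for
    almost every x the section of K agrees almost everywhere with that of \<open>g\<close>, and
    completeness transfers measurability.\<close>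
  obtain g where g: "g \<in> borel_measurable (lborel :: ((real^'n) \<times> (real^'n)) measure)"
    and ae: "AE z in lborel. (\<lambda>(x, y). K x y) z = g z"
    using completion_ex_borel_measurable_real[OF K] by auto
  have g2[measurable]: "g \<in> borel_measurable (borel \<Otimes>\<^sub>M borel)"
    using g by (simp add: borel_prod)
  have "AE z in lborel \<Otimes>\<^sub>M lborel. (\<lambda>(x, y). K x y) z = g z"
    using ae by (subst lborel_prod) (rule ae)
  then have ae2: "AE x in lborel. AE y in lborel. K x y = g (x, y)"
    using lborel_pair.AE_pair by force
  have good: "AE x in lborel. K x \<in> borel_measurable lebesgue"
    using ae2
  proof eventually_elim
    fix x assume *: "AE y in lborel. K x y = g (x, y)"
    have "(\<lambda>y. g (x, y)) \<in> borel_measurable borel" by measurable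
    then have "(\<lambda>y. g (x, y)) \<in> borel_measurable lebesgue"
      by (intro measurable_completion) simp
    moreover have "AE y in lebesgue. g (x, y) = K x y"
      using AE_completion[OF *] by eventually_elim simp
    ultimately show "K x \<in> borel_measurable lebesgue"
      by (rule borel_measurable_AE)
  qed
  \<comment> \<open>The exceptional set of first arguments is null, so it cannot contain a box of
    positive volume about x.\<close>
  have near: "\<exists>x'. x' - x \<in> cube \<epsilon> \<and> K x' \<in> borel_measurable lebesgue" if "\<epsilon> > 0" for \<epsilon>
  proof (rule ccontr)
    assume bad: "\<not> ?thesis"
    have "x' - x \<in> cube \<epsilon>" if "x' \<in> cbox (x - vec \<epsilon>) (x + vec \<epsilon>)" for x'
      using that by (auto simp: mem_cube mem_box_cart abs_le_iff algebra_simps)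
    with bad have "\<forall>x'\<in>cbox (x - vec \<epsilon>) (x + vec \<epsilon>). K x' \<notin> borel_measurable lebesgue"
      by blast
    then have "AE x' in lborel. x' \<notin> cbox (x - vec \<epsilon>) (x + vec \<epsilon>)"
      using good by (auto elim: eventually_mono)
    then have "emeasure lborel (cbox (x - vec \<epsilon>) (x + vec \<epsilon>)) = 0"
      by (subst (asm) AE_iff_measurable[OF _ refl]) auto
    moreover have "measure lborel (cbox (x - vec \<epsilon>) (x + vec \<epsilon>)) = (2 * \<epsilon>) ^ CARD('n)"
      using that by (subst content_cbox_cart)
        (auto simp: interval_ne_empty_cart)
    ultimately show False
      using that by (auto simp: measure_def)
  qed
  \<comment> \<open>The errors 2^(-m) are summable. Therefore the sum of the reflected majorants is
    integrable, hence finite almost everywhere, which forces pointwise convergence of the chosen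
    sections to \<open>K x\<close> at almost every y.\<close>
  have "\<exists>x' H. K x' \<in> borel_measurable lebesgue \<and> H \<in> borel_measurable borel \<and>
      (\<integral>\<^sup>+ y. H y \<partial>lborel) \<le> ennreal ((1/2) ^ m) \<and> (\<forall>y. ennreal \<bar>K x' y - K x y\<bar> \<le> H (x - y))" for m :: nat
  proof -
    obtain \<epsilon> H where "\<epsilon> > 0" "H \<in> borel_measurable borel" "(\<integral>\<^sup>+ y. H y \<partial>lborel) \<le> ennreal ((1/2) ^ m)"
      and "\<And>x x' y. x' - x \<in> cube \<epsilon> \<Longrightarrow> ennreal \<bar>K x' y - K x y\<bar> \<le> H (x - y)"
      using kernel_modulus[OF reg, of "(1/2)^m"] by auto
    with near[of \<epsilon>] show ?thesis by blast
  qed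
  then obtain X H where X: "\<And>m. K (X m) \<in> borel_measurable lebesgue"
    and [measurable]: "\<And>m::nat. H m \<in> borel_measurable borel"
    and Hi: "\<And>m. (\<integral>\<^sup>+ y. H m y \<partial>lborel) \<le> ennreal ((1/2) ^ m)"
    and HK: "\<And>m y. ennreal \<bar>K (X m) y - K x y\<bar> \<le> H m (x - y)"
    by metis
  have "(\<integral>\<^sup>+ y. (\<Sum>m. H m (x - y)) \<partial>lborel) = (\<Sum>m. \<integral>\<^sup>+ y. H m (x - y) \<partial>lborel)"
    by (rule nn_integral_suminf) measurable
  also have "\<dots> = (\<Sum>m. \<integral>\<^sup>+ y. H m y \<partial>lborel)"
    by (simp add: nn_integral_reflect_lborel)
  also have "\<dots> \<le> (\<Sum>m. ennreal ((1/2) ^ m))"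
    by (intro suminf_le Hi) auto
  also have "\<dots> = ennreal (\<Sum>m. (1/2) ^ m)"
    by (rule suminf_ennreal2) auto
  finally have "(\<integral>\<^sup>+ y. (\<Sum>m. H m (x - y)) \<partial>lborel) \<noteq> \<infinity>"
    by (auto simp: top_unique)
  then have "AE y in lborel. (\<Sum>m. H m (x - y)) \<noteq> \<infinity>"
    by (intro nn_integral_PInf_AE) measurable
  then have "AE y in lborel. lim (\<lambda>m. K (X m) y) = K x y"
  proof eventually_elim
    fix y assume fin: "(\<Sum>m. H m (x - y)) \<noteq> \<infinity>"
    have "(\<Sum>m. ennreal \<bar>K (X m) y - K x y\<bar>) \<le> (\<Sum>m. H m (x - y))"
      by (intro suminf_le HK) auto
    then have "(\<Sum>m. ennreal \<bar>K (X m) y - K x y\<bar>) \<noteq> \<top>"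
      using fin by (auto simp: top_unique)
    then have "summable (\<lambda>m. \<bar>K (X m) y - K x y\<bar>)"
      by (intro summable_suminf_not_top) auto
    then have "(\<lambda>m. \<bar>K (X m) y - K x y\<bar>) \<longlonglongrightarrow> 0"
      by (rule summable_LIMSEQ_zero)
    then have "(\<lambda>m. K (X m) y) \<longlonglongrightarrow> K x y"
      by (simp add: LIM_zero_iff tendsto_rabs_zero_iff)
    then show "lim (\<lambda>m. K (X m) y) = K x y" by (rule limI)
  qed
  then have "AE y in lebesgue. lim (\<lambda>m. K (X m) y) = K x y"
    by (rule AE_completion)
  moreover have "(\<lambda>y. lim (\<lambda>m. K (X m) y)) \<in> borel_measurable lebesgue"
    by (intro borel_measurable_lim_metric X)
  ultimately show ?thesis
    using borel_measurable_AE by blast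
qed

section \<open>Uniform bounds and equicontinuity of reproduced functions\<close>

lemma le_one_plus_powr:
  assumes "0 \<le> t" "1 \<le> p"
  shows "t \<le> 1 + t powr (p :: real)"
proof (cases "t \<le> 1")
  case True
  then show ?thesis by (smt (verit) powr_ge_zero)
next
  case False
  then have "t powr 1 \<le> t powr p"
    using assms by (intro powr_mono) auto
  then show ?thesis using False by simp
qed

text \<open>Both terms of the bound are integrable in \<open>y\<close>; this replaces Hoelder's inequality.\<close>

lemma kernel_mult_le:
  assumes "kernel_decay C \<alpha> K" "C > 0" "\<alpha> \<ge> 0" "1 \<le> p"
  shows "\<bar>K x y * t\<bar> \<le> C / (1 + l1_norm (x - y)) powr \<alpha> + C * \<bar>t\<bar> powr p"
proof -
  have K: "\<bar>K x y\<bar> \<le> C / (1 + l1_norm (x - y)) powr \<alpha>"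
    using assms(1) by (simp add: kernel_decay_def)
  have one: "1 \<le> (1 + l1_norm (x - y)) powr \<alpha>"
    using l1_norm_nonneg[of "x - y"] assms(3) by (intro ge_one_powr_ge_zero) auto
  have "C / (1 + l1_norm (x - y)) powr \<alpha> \<le> C / 1"
    using one assms(2) by (intro divide_left_mono) auto
  then have KC: "\<bar>K x y\<bar> \<le> C"
    using K by simp
  have "\<bar>K x y * t\<bar> \<le> \<bar>K x y\<bar> * (1 + \<bar>t\<bar> powr p)"
    unfolding abs_mult using le_one_plus_powr[of "\<bar>t\<bar>" p] assms(4) by (intro mult_left_mono) auto
  also have "\<dots> = \<bar>K x y\<bar> + \<bar>K x y\<bar> * \<bar>t\<bar> powr p"
    by (simp add: algebra_simps)
  also have "\<dots> \<le> C / (1 + l1_norm (x - y)) powr \<alpha> + C * \<bar>t\<bar> powr p"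
    using K KC by (intro add_mono mult_right_mono) auto
  finally show ?thesis .
qed

text \<open>Integrate the bound of \<open>kernel_mult_le\<close> over y. By reflection the weight
  contributes the same constant \<open>J\<close> for every x, so the estimate is uniform in x and
  involves f only through the integral of |f|^p.\<close>

lemma kernel_op_integrable_bounded:
  fixes K :: "real ^ 'n \<Rightarrow> real ^ 'n \<Rightarrow> real"
  assumes dec: "kernel_decay C \<alpha> K" and C: "C > 0" and \<alpha>: "\<alpha> > real CARD('n) + 1" and p: "1 \<le> p"
    and Kx: "K x \<in> borel_measurable lebesgue"
    and f: "f \<in> Lp_space p"
  defines "J \<equiv> enn2real (\<integral>\<^sup>+ y. ennreal (C / (1 + l1_norm (y :: real^'n)) powr \<alpha>) \<partial>lborel)"
  shows "integrable lebesgue (\<lambda>y. K x y * f y)"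
    and "\<bar>kernel_op K f x\<bar> \<le> J + C * (LINT y|lebesgue. \<bar>f y\<bar> powr p)"
proof -
  let ?w = "\<lambda>y :: real^'n. C / (1 + l1_norm y) powr \<alpha>"
  have f_meas[measurable]: "f \<in> borel_measurable lebesgue" and fi: "integrable lebesgue (\<lambda>y. \<bar>f y\<bar> powr p)"
    using f by (auto simp: Lp_space_def)
  note Kx[measurable]
  have J: "(\<integral>\<^sup>+ y. ennreal (?w (x - y)) \<partial>lebesgue) = ennreal J"
    using nn_integral_reflect_lborel[of "\<lambda>y. ennreal (?w y)" x] decay_integral_finite[OF \<alpha> C]
    by (simp add: nn_integral_completion J_def less_top)
  have fI: "(\<integral>\<^sup>+ y. ennreal (C * \<bar>f y\<bar> powr p) \<partial>lebesgue) = ennreal (C * (LINT y|lebesgue. \<bar>f y\<bar> powr p))"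
    using fi C by (subst nn_integral_eq_integral) auto
  have wm: "(\<lambda>y. ennreal (?w (x - y))) \<in> borel_measurable lebesgue"
    by (intro measurable_completion) measurable
  have "(\<integral>\<^sup>+ y. ennreal (norm (K x y * f y)) \<partial>lebesgue)
      \<le> (\<integral>\<^sup>+ y. ennreal (?w (x - y)) + ennreal (C * \<bar>f y\<bar> powr p) \<partial>lebesgue)"
    using kernel_mult_le[OF dec C _ p, of x] \<alpha> C
    by (intro nn_integral_mono) (auto simp flip: ennreal_plus intro!: ennreal_leI)
  also have "\<dots> = (\<integral>\<^sup>+ y. ennreal (?w (x - y)) \<partial>lebesgue) + (\<integral>\<^sup>+ y. ennreal (C * \<bar>f y\<bar> powr p) \<partial>lebesgue)"
    by (intro nn_integral_add wm) measurable
  also have "\<dots> = ennreal (J + C * (LINT y|lebesgue. \<bar>f y\<bar> powr p))"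
    using C by (simp add: J fI ennreal_plus J_def)
  finally have le: "(\<integral>\<^sup>+ y. ennreal (norm (K x y * f y)) \<partial>lebesgue) \<le> ennreal (J + C * (LINT y|lebesgue. \<bar>f y\<bar> powr p))" .
  show int: "integrable lebesgue (\<lambda>y. K x y * f y)"
    using le by (intro integrableI_bounded) (auto intro: le_less_trans)
  have "ennreal (norm (kernel_op K f x)) \<le> ennreal (J + C * (LINT y|lebesgue. \<bar>f y\<bar> powr p))"
    unfolding kernel_op_def using integral_norm_bound_ennreal[OF int] le by (rule order_trans)
  then show "\<bar>kernel_op K f x\<bar> \<le> J + C * (LINT y|lebesgue. \<bar>f y\<bar> powr p)"
    using C by (subst (asm) ennreal_le_iff) (auto simp: J_def)
qed

text \<open>The difference f(x') - f(x) is the integral of (K(x',y) - K(x,y)) f(y). The sup bound on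
  f and the L1 bound on the majorant \<open>H\<close> of the kernel difference give the product B
  e.\<close>

lemma reproducing_modulus:
  fixes K :: "real ^ 'n \<Rightarrow> real ^ 'n \<Rightarrow> real"
  assumes int: "\<And>x. integrable lebesgue (\<lambda>y. K x y * f y)"
    and rep: "\<And>x. f x = kernel_op K f x" and B: "\<And>x. \<bar>f x\<bar> \<le> B"
    and H[measurable]: "H \<in> borel_measurable borel" and He: "(\<integral>\<^sup>+ y. H y \<partial>lborel) \<le> ennreal e" and "e \<ge> 0"
    and HK: "\<And>y. ennreal \<bar>K x' y - K x y\<bar> \<le> H (x - y)"
  shows "\<bar>f x' - f x\<bar> \<le> B * e"
proof -
  have B0: "0 \<le> B" using B[of x] by linarith
  have int': "integrable lebesgue (\<lambda>y. K x' y * f y - K x y * f y)"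
    using int by (intro Bochner_Integration.integrable_diff)
  have "f x' - f x = (LINT y|lebesgue. K x' y * f y - K x y * f y)"
    using int by (simp add: rep[of x'] rep[of x] kernel_op_def)
  then have "ennreal \<bar>f x' - f x\<bar> \<le> (\<integral>\<^sup>+ y. ennreal (norm (K x' y * f y - K x y * f y)) \<partial>lebesgue)"
    using integral_norm_bound_ennreal[OF int'] by simp
  also have "\<dots> \<le> (\<integral>\<^sup>+ y. ennreal B * H (x - y) \<partial>lebesgue)"
  proof (rule nn_integral_mono)
    fix y
    have "norm (K x' y * f y - K x y * f y) = \<bar>f y\<bar> * \<bar>K x' y - K x y\<bar>"
      by (simp add: abs_mult flip: left_diff_distrib)
    also have "\<dots> \<le> B * \<bar>K x' y - K x y\<bar>"
      by (intro mult_right_mono B) auto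
    finally have "ennreal (norm (K x' y * f y - K x y * f y)) \<le> ennreal B * ennreal \<bar>K x' y - K x y\<bar>"
      using B0 by (simp add: ennreal_leI flip: ennreal_mult)
    also have "\<dots> \<le> ennreal B * H (x - y)"
      by (intro mult_left_mono HK) auto
    finally show "ennreal (norm (K x' y * f y - K x y * f y)) \<le> ennreal B * H (x - y)" .
  qed
  also have "\<dots> = ennreal B * (\<integral>\<^sup>+ y. H y \<partial>lborel)"
    by (simp add: nn_integral_completion nn_integral_cmult nn_integral_reflect_lborel)
  also have "\<dots> \<le> ennreal B * ennreal e"
    by (intro mult_left_mono He) auto
  finally show ?thesis
    using B0 \<open>e \<ge> 0\<close> by (subst (asm) ennreal_mult[symmetric]) (auto simp: ennreal_le_iff)
qed

text \<open>This is the closed unit ball of V: the identity f = Tf itself exhibits f as an element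
  of the range. The norm condition is imposed on the p-th power, the form in which all estimates are
  made.\<close>

definition reproducing_ball :: "real \<Rightarrow> (real ^ 'n \<Rightarrow> real ^ 'n \<Rightarrow> real) \<Rightarrow> (real ^ 'n \<Rightarrow> real) set" where
  "reproducing_ball p K =
    {f \<in> Lp_space p. (\<forall>x. f x = kernel_op K f x) \<and> (LINT x|lebesgue. \<bar>f x\<bar> powr p) \<le> 1}"

text \<open>The sup bound is \<open>kernel_op_integrable_bounded\<close> with the integral of |f|^p
  at most 1, which gives B = J + C. For the modulus, the kernel is controlled to precision \<eta>/B,
  and the scale \<epsilon> obtained depends on K, B and \<eta> but not on f.\<close>

lemma reproducing_ball_equicontinuous:
  fixes K :: "real ^ 'n \<Rightarrow> real ^ 'n \<Rightarrow> real"
  assumes K: "(\<lambda>(x, y). K x y) \<in> borel_measurable lebesgue" and reg: "kernel_regular K"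
    and dec: "kernel_decay C \<alpha> K" and C: "C > 0" and \<alpha>: "\<alpha> > real CARD('n) + 1" and p: "1 \<le> p"
  obtains B where "B > 0" and "\<And>f x. f \<in> reproducing_ball p K \<Longrightarrow> \<bar>f x\<bar> \<le> B"
    and "\<And>\<eta>. \<eta> > 0 \<Longrightarrow>
      \<exists>d>0. \<forall>f\<in>reproducing_ball p K. \<forall>x x'. dist x' x < d \<longrightarrow> \<bar>f x' - f x\<bar> \<le> \<eta>"
proof -
  define J where "J = enn2real (\<integral>\<^sup>+ y. ennreal (C / (1 + l1_norm (y :: real^'n)) powr \<alpha>) \<partial>lborel)"
  define B where "B = J + C"
  have J0: "J \<ge> 0" by (simp add: J_def)
  have B0: "B > 0" using C J0 by (simp add: B_def)
  note sec = kernel_section_measurable[OF K reg]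
  have bd: "\<bar>f x\<bar> \<le> B" if "f \<in> reproducing_ball p K" for f x
  proof -
    have f: "f \<in> Lp_space p" and rep: "\<And>x. f x = kernel_op K f x"
      and I: "(LINT y|lebesgue. \<bar>f y\<bar> powr p) \<le> 1"
      using that by (auto simp: reproducing_ball_def)
    have "\<bar>f x\<bar> \<le> J + C * (LINT y|lebesgue. \<bar>f y\<bar> powr p)"
      using kernel_op_integrable_bounded(2)[OF dec C \<alpha> p sec f, of x] by (simp add: J_def flip: rep)
    also have "\<dots> \<le> J + C * 1"
      using C I by (intro add_left_mono mult_left_mono) auto
    finally show ?thesis by (simp add: B_def)
  qed
  have eq: "\<exists>d>0. \<forall>f\<in>reproducing_ball p K. \<forall>x x'. dist x' x < d \<longrightarrow> \<bar>f x' - f x\<bar> \<le> \<eta>"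
    if "\<eta> > 0" for \<eta>
  proof -
    have pos: "\<eta> / B > 0" using that B0 by simp
    obtain \<epsilon> H where \<epsilon>: "\<epsilon> > 0" and H: "H \<in> borel_measurable borel"
      and He: "(\<integral>\<^sup>+ y. H y \<partial>lborel) \<le> ennreal (\<eta> / B)"
      and HK: "\<And>x x' y. x' - x \<in> cube \<epsilon> \<Longrightarrow> ennreal \<bar>K x' y - K x y\<bar> \<le> H (x - y)"
      by (rule kernel_modulus[OF reg pos]) (rule that)
    show ?thesis
    proof (intro exI[of _ \<epsilon>] conjI ballI impI allI \<epsilon>)
      fix f and x x' :: "real^'n" assume ball: "f \<in> reproducing_ball p K" and d: "dist x' x < \<epsilon>"
      have f: "f \<in> Lp_space p" and rep: "\<And>x. f x = kernel_op K f x"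
        using ball by (auto simp: reproducing_ball_def)
      have "\<bar>(x' - x) $ i\<bar> \<le> \<epsilon>" for i
        using component_le_norm_cart[of "x' - x" i] d by (simp add: dist_norm)
      then have c: "x' - x \<in> cube \<epsilon>"
        by (simp add: mem_cube)
      have "\<bar>f x' - f x\<bar> \<le> B * (\<eta> / B)"
        by (rule reproducing_modulus[OF kernel_op_integrable_bounded(1)[OF dec C \<alpha> p sec f]
              rep bd[OF ball] H He _ HK[OF c]]) (use pos in simp)
      then show "\<bar>f x' - f x\<bar> \<le> \<eta>"
        using B0 by simp
    qed
  qed
  show ?thesis
    by (rule that[OF B0]) (fact bd, fact eq)
qed

section \<open>Uniform deviations of empirical means\<close>

text \<open>This is the total boundedness half of Arzela-Ascoli. A function is encoded by its
  values, rounded to a grid, at finitely many centres; there are finitely many codes, and one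
  function is kept for each code that occurs.\<close>

lemma equicontinuous_finite_net:
  fixes F :: "('a::metric_space \<Rightarrow> real) set"
  assumes "compact S" and B: "\<And>f x. f \<in> F \<Longrightarrow> x \<in> S \<Longrightarrow> \<bar>f x\<bar> \<le> B"
    and eq: "\<And>\<eta>. \<eta> > 0 \<Longrightarrow> \<exists>d>0. \<forall>f\<in>F. \<forall>x\<in>S. \<forall>x'\<in>S. dist x' x < d \<longrightarrow> \<bar>f x' - f x\<bar> \<le> \<eta>"
    and "\<eta> > 0"
  obtains F0 where "finite F0" "F0 \<subseteq> F" "\<And>f. f \<in> F \<Longrightarrow> \<exists>g\<in>F0. \<forall>x\<in>S. \<bar>f x - g x\<bar> \<le> \<eta>"
proof -
  \<comment> \<open>Three errors of size at most h occur: from f(x) to f(c), from f(c) to g(c), and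
    from g(c) to g(x).\<close>
  define h where "h = \<eta> / 3"
  have h: "h > 0" using assms by (simp add: h_def)
  obtain d where d: "d > 0" and dF: "\<And>f x x'. f \<in> F \<Longrightarrow> x \<in> S \<Longrightarrow> x' \<in> S \<Longrightarrow> dist x' x < d \<Longrightarrow> \<bar>f x' - f x\<bar> \<le> h"
    using eq[OF h] by blast
  have cov: "S \<subseteq> (\<Union>c\<in>S. ball c d)"
    using d by auto
  obtain T where T: "T \<subseteq> S" "finite T" "S \<subseteq> (\<Union>c\<in>T. ball c d)"
    by (rule compactE_image[OF \<open>compact S\<close> open_ball cov]) (rule that)
  define code where "code f = restrict (\<lambda>c. \<lfloor>f c / h\<rfloor>) T" for f :: "'a \<Rightarrow> real"
  have "code ` F \<subseteq> T \<rightarrow>\<^sub>E {\<lfloor>- B / h\<rfloor>..\<lfloor>B / h\<rfloor>}"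
  proof (intro image_subsetI)
    fix f assume f: "f \<in> F"
    have "\<lfloor>- B / h\<rfloor> \<le> \<lfloor>f c / h\<rfloor> \<and> \<lfloor>f c / h\<rfloor> \<le> \<lfloor>B / h\<rfloor>" if "c \<in> T" for c
    proof -
      have "- B \<le> f c" "f c \<le> B"
        using B[OF f, of c] that T(1) by auto
      then show ?thesis
        using h by (intro conjI floor_mono divide_right_mono) auto
    qed
    then show "code f \<in> T \<rightarrow>\<^sub>E {\<lfloor>- B / h\<rfloor>..\<lfloor>B / h\<rfloor>}"
      by (auto simp: code_def)
  qed
  then have fin: "finite (code ` F)"
    by (rule finite_subset) (intro finite_PiE T finite_atLeastAtMost_int)
  show ?thesis
  proof (rule that[of "inv_into F code ` code ` F"])
    show "finite (inv_into F code ` code ` F)"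
      using fin by simp
    show "inv_into F code ` code ` F \<subseteq> F"
      by (auto intro: inv_into_into)
    fix f assume f: "f \<in> F"
    define g where "g = inv_into F code (code f)"
    have g: "g \<in> F" "code g = code f"
      using f by (auto simp: g_def inv_into_into f_inv_into_f)
    have "\<bar>f x - g x\<bar> \<le> \<eta>" if x: "x \<in> S" for x
    proof -
      obtain c where c: "c \<in> T" "dist c x < d"
        using T(3) x by auto
      have "\<lfloor>g c / h\<rfloor> = \<lfloor>f c / h\<rfloor>"
        using fun_cong[OF g(2), of c] c(1) by (simp add: code_def)
      then have "\<bar>f c / h - g c / h\<bar> \<le> 1"
        by linarith
      then have "\<bar>f c - g c\<bar> \<le> h"
        using h by (simp add: field_simps flip: diff_divide_distrib)
      moreover have "\<bar>f c - f x\<bar> \<le> h" "\<bar>g c - g x\<bar> \<le> h"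
        using dF[OF f x _ c(2)] dF[OF g(1) x _ c(2)] c(1) T(1) by auto
      ultimately show ?thesis
        unfolding h_def by linarith
    qed
    then show "\<exists>g\<in>inv_into F code ` code ` F. \<forall>x\<in>S. \<bar>f x - g x\<bar> \<le> \<eta>"
      using f by (auto simp: g_def)
  qed
qed

text \<open>Hoeffding's inequality is applied to the members of a finite net and passed on to all of
  \<open>F\<close> by approximation. The net is chosen before r, so \<open>A\<close> and
  \<open>c\<close> do not depend on r.\<close>

lemma (in prob_space) uniform_Hoeffding:
  fixes X :: "nat \<Rightarrow> 'a \<Rightarrow> 'b::metric_space"
  assumes ind: "indep_vars (\<lambda>_. borel) X {1..}"
    and D: "\<And>j. j \<ge> 1 \<Longrightarrow> distr M borel (X j) = D"
    and S: "compact S" and DS: "AE x in D. x \<in> S"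
    and F: "F \<subseteq> borel_measurable borel"
    and B: "\<And>f x. f \<in> F \<Longrightarrow> x \<in> S \<Longrightarrow> \<bar>f x\<bar> \<le> B" and "B > 0"
    and eq: "\<And>\<eta>. \<eta> > 0 \<Longrightarrow> \<exists>d>0. \<forall>f\<in>F. \<forall>x\<in>S. \<forall>x'\<in>S. dist x' x < d \<longrightarrow> \<bar>f x' - f x\<bar> \<le> \<eta>"
    and "\<eta> > 0"
  obtains A c where "A > 0" "c > 0"
    and "\<And>r::nat. r \<ge> 1 \<Longrightarrow> \<exists>G\<in>events. prob G \<ge> 1 - A * exp (- (c * real r)) \<and>
      (\<forall>\<omega>\<in>G. \<forall>f\<in>F. \<bar>(\<Sum>j=1..r. f (X j \<omega>)) - real r * (LINT x|D. f x)\<bar> \<le> real r * \<eta>)"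
proof -
  have X[measurable]: "random_variable borel (X j)" if "j \<ge> 1" for j
    using ind that by (auto simp: indep_vars_def)
  have [simp]: "sets D = sets borel" "space D = UNIV"
    using D[of 1, symmetric] by auto
  interpret D: prob_space D
    using prob_space_distr[OF X[of 1]] D[of 1] by simp
  have "closed S" using S by (rule compact_imp_closed)
  then have [measurable]: "S \<in> sets borel" by simp
  have Fm[measurable]: "f \<in> borel_measurable borel" if "f \<in> F" for f
    using F that by auto
  have XS: "AE \<omega> in M. X j \<omega> \<in> S" if "j \<ge> 1" for j
    using DS that by (subst (asm) D[OF that, symmetric], subst (asm) AE_distr_iff) auto
  have Dint: "integrable D f" if "f \<in> F" for f
  proof (rule D.integrable_const_bound[of _ B])
    show "AE x in D. norm (f x) \<le> B"
      using DS by eventually_elim (simp add: B[OF that])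
    show "f \<in> borel_measurable D"
      using Fm[OF that] by (simp cong: measurable_cong_sets)
  qed
  obtain F0 where F0: "finite F0" "F0 \<subseteq> F" "\<And>f. f \<in> F \<Longrightarrow> \<exists>g\<in>F0. \<forall>x\<in>S. \<bar>f x - g x\<bar> \<le> \<eta> / 4"
  proof (rule equicontinuous_finite_net[OF S])
    show "\<bar>f x\<bar> \<le> B" if "f \<in> F" "x \<in> S" for f x
      using that by (rule B)
    show "\<exists>d>0. \<forall>f\<in>F. \<forall>x\<in>S. \<forall>x'\<in>S. dist x' x < d \<longrightarrow> \<bar>f x' - f x\<bar> \<le> h" if "h > 0" for h
      using that by (rule eq)
    show "\<eta> / 4 > 0"
      using \<open>\<eta> > 0\<close> by simp
  qed (rule that)
  \<comment> \<open>Hoeffding's exponent for deviation r \<eta>/2 and values in [-B, B] is 2 (r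
    \<eta>/2)^2 / (r (2B)^2) = r \<eta>^2 / (8 B^2).\<close>
  define c where "c = \<eta>\<^sup>2 / (8 * B\<^sup>2)"
  have c: "c > 0" using \<open>\<eta> > 0\<close> \<open>B > 0\<close> by (simp add: c_def)
  define m where "m g = (LINT x|D. g x)" for g :: "'b \<Rightarrow> real"
  \<comment> \<open>The tolerance \<eta> is split as \<eta>/2 for the deviation of a net function
    and \<eta>/4 each for replacing f by it in the empirical sum and in the mean.\<close>
  define bad where "bad r g = {\<omega> \<in> space M. real r * (\<eta> / 2) \<le> \<bar>(\<Sum>j=1..r. g (X j \<omega>)) - real r * m g\<bar>}" for r :: nat and g :: "'b \<Rightarrow> real"
  have bad_meas: "bad r g \<in> events" if "g \<in> F" for r :: nat and g :: "'b \<Rightarrow> real"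
  proof -
    have [measurable]: "(\<lambda>\<omega>. \<Sum>j=1..r. g (X j \<omega>)) \<in> borel_measurable M"
      using that by (intro borel_measurable_sum measurable_compose[OF X Fm]) auto
    show ?thesis unfolding bad_def by measurable
  qed
  have Hoeffding: "prob (bad r g) \<le> 2 * exp (- (c * real r))" if "g \<in> F" "r \<ge> 1" for g r
  proof -
    have mg: "m g = expectation (\<lambda>\<omega>. g (X 1 \<omega>))"
      unfolding m_def D[of 1, OF order_refl, symmetric] using that by (intro integral_distr) auto
    interpret H: Hoeffding_ineq_iid M "{1..r}" "\<lambda>j \<omega>. g (X j \<omega>)" "\<lambda>\<omega>. g (X 1 \<omega>)" "-B" B
      "expectation (\<lambda>\<omega>. g (X 1 \<omega>))"
    proof unfold_locales
      show "indep_vars (\<lambda>_. borel) (\<lambda>j \<omega>. g (X j \<omega>)) {1..r}"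
        by (rule indep_vars_compose2[OF indep_vars_subset[OF ind]]) (use that in auto)
      show "distr M borel (\<lambda>\<omega>. g (X i \<omega>)) = distr M borel (\<lambda>\<omega>. g (X 1 \<omega>))" if "i \<in> {1..r}" for i
        using distr_distr[OF Fm[OF \<open>g \<in> F\<close>] X, of i] distr_distr[OF Fm[OF \<open>g \<in> F\<close>] X, of 1] that D
        by (simp add: comp_def)
      show "random_variable borel (\<lambda>\<omega>. g (X 1 \<omega>))"
        using that by measurable
      show "AE \<omega> in M. g (X 1 \<omega>) \<in> {- B..B}"
        using XS[of 1, OF order_refl]
      proof eventually_elim
        case (elim \<omega>)
        then have "\<bar>g (X 1 \<omega>)\<bar> \<le> B" by (rule B[OF \<open>g \<in> F\<close>])
        then show ?case unfolding atLeastAtMost_iff by linarith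
      qed
    qed (rule finite_atLeastAtMost)
    have "prob (bad r g) \<le> 2 * exp (- 2 * (real r * (\<eta> / 2))\<^sup>2 / (real r * (B - - B)\<^sup>2))"
    proof -
      have "real r * (\<eta> / 2) \<ge> 0" "- B < B" "{1..r} \<noteq> {}"
        using that \<open>\<eta> > 0\<close> \<open>B > 0\<close> by auto
      from H.Hoeffding_ineq_abs_ge[OF this] show ?thesis
        unfolding bad_def mg card_atLeastAtMost diff_Suc_1 .
    qed
    also have "- 2 * (real r * (\<eta> / 2))\<^sup>2 / (real r * (B - - B)\<^sup>2) = - (c * real r)"
      using that \<open>B > 0\<close> by (simp add: c_def field_simps power2_eq_square)
    finally show ?thesis .
  qed
  show ?thesis
  \<comment> \<open>The summand 1 keeps the constant positive even if the net is empty.\<close>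
  proof (rule that[of "2 * real (card F0) + 1" c])
    show "2 * real (card F0) + 1 > 0" by simp
    show "c > 0" by fact
    fix r :: nat assume r: "r \<ge> 1"
    \<comment> \<open>The net approximates only on \<open>S\<close>, so the null event that some
      sample point falls outside \<open>S\<close> is removed as well.\<close>
    define N where "N = {\<omega> \<in> space M. \<exists>j\<in>{1..r}. X j \<omega> \<notin> S}"
    have N_meas: "N \<in> events"
    proof -
      have "N = (\<Union>j\<in>{1..r}. {\<omega> \<in> space M. X j \<omega> \<notin> S})"
        by (auto simp: N_def)
      also have "\<dots> \<in> events"
        by (intro sets.finite_UN) auto
      finally show ?thesis .
    qed
    have "AE \<omega> in M. \<forall>j\<in>{1..r}. X j \<omega> \<in> S"
      using XS by (intro AE_finite_allI) auto
    then have "AE \<omega> in M. \<omega> \<notin> N"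
      by eventually_elim (auto simp: N_def)
    then have N0: "prob N = 0"
      using N_meas by (simp add: prob_eq_0)
    define Q where "Q = N \<union> (\<Union>g\<in>F0. bad r g)"
    have UF: "(\<Union>g\<in>F0. bad r g) \<in> events"
      using F0 bad_meas by (intro sets.finite_UN) auto
    have "prob (\<Union>g\<in>F0. bad r g) \<le> (\<Sum>g\<in>F0. prob (bad r g))"
      using F0 bad_meas by (intro finite_measure_subadditive_finite) auto
    also have "\<dots> \<le> (\<Sum>g\<in>F0. 2 * exp (- (c * real r)))"
      using F0 r by (intro sum_mono Hoeffding) auto
    finally have "prob (\<Union>g\<in>F0. bad r g) \<le> 2 * real (card F0) * exp (- (c * real r))"
      by simp
    then have "prob Q \<le> 2 * real (card F0) * exp (- (c * real r))"
      using measure_Un_le[OF N_meas UF] N0 unfolding Q_def by linarith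
    also have "\<dots> \<le> (2 * real (card F0) + 1) * exp (- (c * real r))"
      by (intro mult_right_mono) auto
    finally have "prob (space M - Q) \<ge> 1 - (2 * real (card F0) + 1) * exp (- (c * real r))"
      using N_meas UF by (subst prob_compl) (auto simp: Q_def)
    moreover have "space M - Q \<in> events"
      using N_meas UF by (auto simp: Q_def)
    moreover have "\<bar>(\<Sum>j=1..r. f (X j \<omega>)) - real r * (LINT x|D. f x)\<bar> \<le> real r * \<eta>"
      if \<omega>: "\<omega> \<in> space M - Q" and f: "f \<in> F" for \<omega> f
    proof -
      obtain g where g: "g \<in> F0" and fg: "\<And>x. x \<in> S \<Longrightarrow> \<bar>f x - g x\<bar> \<le> \<eta> / 4"
        using F0(3)[OF f] by auto
      have gF: "g \<in> F" using g F0 by auto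
      have XS': "X j \<omega> \<in> S" if "j \<in> {1..r}" for j
        using \<omega> that by (auto simp: Q_def N_def)
      have "\<omega> \<notin> bad r g"
        using \<omega> g by (auto simp: Q_def)
      then have 1: "\<bar>(\<Sum>j=1..r. g (X j \<omega>)) - real r * m g\<bar> \<le> real r * (\<eta> / 2)"
        using \<omega> by (auto simp: bad_def)
      have "\<bar>\<Sum>j=1..r. f (X j \<omega>) - g (X j \<omega>)\<bar> \<le> (\<Sum>j=1..r. \<bar>f (X j \<omega>) - g (X j \<omega>)\<bar>)"
        by (rule sum_abs)
      also have "\<dots> \<le> (\<Sum>j=1..r. \<eta> / 4)"
        by (intro sum_mono fg XS')
      finally have 2: "\<bar>(\<Sum>j=1..r. f (X j \<omega>)) - (\<Sum>j=1..r. g (X j \<omega>))\<bar> \<le> real r * (\<eta> / 4)"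
        by (simp add: sum_subtractf)
      have "\<bar>LINT x|D. f x - g x\<bar> \<le> (LINT x|D. \<bar>f x - g x\<bar>)"
        by (rule integral_abs_bound)
      also have "\<dots> \<le> (LINT x|D. \<eta> / 4)"
        using DS fg Dint[OF f] Dint[OF gF] by (intro integral_mono_AE) (auto elim!: eventually_mono)
      finally have "\<bar>(LINT x|D. f x) - m g\<bar> \<le> \<eta> / 4"
        using Dint[OF f] Dint[OF gF] using D.prob_space by (simp add: m_def)
      then have 3: "\<bar>real r * (LINT x|D. f x) - real r * m g\<bar> \<le> real r * (\<eta> / 4)"
        unfolding right_diff_distrib[symmetric] abs_mult by (simp add: mult_left_mono del: times_divide_eq_right)
      show ?thesis
        using 1 2 3 by linarith
    qed
    ultimately show "\<exists>G\<in>events. prob G \<ge> 1 - (2 * real (card F0) + 1) * exp (- (c * real r)) \<and>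
      (\<forall>\<omega>\<in>G. \<forall>f\<in>F. \<bar>(\<Sum>j=1..r. f (X j \<omega>)) - real r * (LINT x|D. f x)\<bar> \<le> real r * \<eta>)"
      by blast
  qed
qed

text \<open>For each i the sum is a continuous function of the sample sequence in the product
  topology, so its bounds cut out a closed set. An intersection over any index set stays closed, and
  second countability makes the sample sequence Borel measurable once its coordinates are.\<close>

lemma sets_all_sum_bounds:
  fixes X :: "nat \<Rightarrow> 'w \<Rightarrow> 'a::{second_countable_topology, t2_space}" and h :: "'i \<Rightarrow> 'a \<Rightarrow> real"
  assumes X: "\<And>j. j \<ge> 1 \<Longrightarrow> X j \<in> borel_measurable M" and h: "\<And>i. i \<in> V \<Longrightarrow> continuous_on UNIV (h i)"
  shows "{\<omega> \<in> space M. \<forall>i\<in>V. l i \<le> (\<Sum>j=1..r. h i (X j \<omega>)) \<and> (\<Sum>j=1..r. h i (X j \<omega>)) \<le> u i} \<in> sets M"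
proof -
  \<comment> \<open>The variables X j are measurable for j \<ge> 1, while sequences are indexed from
    0; hence the shift by one here and in \<open>?Z\<close>.\<close>
  let ?P = "\<lambda>i z. l i \<le> (\<Sum>j=1..r. h i (z (j - 1))) \<and> (\<Sum>j=1..r. h i (z (j - 1))) \<le> u i"
  let ?Z = "\<lambda>\<omega> j. X (Suc j) \<omega>"
  have cont: "continuous_on UNIV (\<lambda>z. \<Sum>j=1..r. h i (z (j - 1)))" if "i \<in> V" for i
    by (intro continuous_on_sum continuous_on_compose2[OF h[OF that]] continuous_on_product_coordinates) auto
  have "closed (\<Inter>i\<in>V. {z. ?P i z})"
    by (intro closed_INT ballI closed_Collect_conj closed_Collect_le cont continuous_on_const)
  moreover have "?Z \<in> borel_measurable M"
    by (intro measurable_coordinatewise_then_product X) auto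
  ultimately have "?Z -` (\<Inter>i\<in>V. {z. ?P i z}) \<inter> space M \<in> sets M"
    by (intro measurable_sets) auto
  also have "?Z -` (\<Inter>i\<in>V. {z. ?P i z}) \<inter> space M =
      {\<omega> \<in> space M. \<forall>i\<in>V. l i \<le> (\<Sum>j=1..r. h i (X j \<omega>)) \<and> (\<Sum>j=1..r. h i (X j \<omega>)) \<le> u i}"
    by auto
  finally show ?thesis .
qed

section \<open>The sampling inequality\<close>

lemma reproducing_ball_scaled:
  assumes f: "f \<in> Lp_space p" and rep: "\<And>x. f x = kernel_op K f x"
    and s: "\<bar>s\<bar> powr p * (LINT x|lebesgue. \<bar>f x\<bar> powr p) \<le> 1"
  shows "(\<lambda>x. s * f x) \<in> reproducing_ball p K"
proof -
  have [measurable]: "f \<in> borel_measurable lebesgue" and fi: "integrable lebesgue (\<lambda>x. \<bar>f x\<bar> powr p)"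
    using f by (auto simp: Lp_space_def)
  have pw: "\<bar>s * f x\<bar> powr p = \<bar>s\<bar> powr p * \<bar>f x\<bar> powr p" for x
    by (simp add: abs_mult powr_mult)
  have "(\<lambda>x. s * f x) \<in> Lp_space p"
    using fi by (auto simp: Lp_space_def pw)
  moreover have "s * f x = kernel_op K (\<lambda>x. s * f x) x" for x
    using rep[of x] by (simp add: kernel_op_def mult.left_commute)
  moreover have "(LINT x|lebesgue. \<bar>s * f x\<bar> powr p) \<le> 1"
    using s by (simp add: pw)
  ultimately show ?thesis
    unfolding reproducing_ball_def by blast
qed

lemma continuous_on_powr_abs:
  assumes "continuous_on S f" "p > 0"
  shows "continuous_on S (\<lambda>x. \<bar>f x\<bar> powr p :: real)"
  by (intro continuous_on_powr' continuous_intros assms) (use assms in auto)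

text \<open>A positive multiple of f lies in \<open>reproducing_ball p K\<close>, whose members are
  uniformly continuous; undoing the scaling preserves continuity.\<close>

lemma op_range_continuous:
  fixes K :: "real ^ 'n \<Rightarrow> real ^ 'n \<Rightarrow> real"
  assumes eq: "\<And>\<eta>. \<eta> > 0 \<Longrightarrow>
      \<exists>d>0. \<forall>f\<in>reproducing_ball p K. \<forall>x x'. dist x' x < d \<longrightarrow> \<bar>f x' - f x\<bar> \<le> \<eta>"
    and f: "f \<in> op_range p K" and "p > 0"
  shows "continuous_on UNIV f"
proof -
  define I where "I = (LINT x|lebesgue. \<bar>f x\<bar> powr p)"
  have I: "I \<ge> 0" by (simp add: I_def)
  \<comment> \<open>The summand 1 covers the case I = 0 and gives s^p I = I / (1 + I) \<le>
    1.\<close>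
  define s where "s = (1 + I) powr (- (1 / p))"
  have s: "s > 0" using I by (simp add: s_def)
  have "\<bar>s\<bar> powr p = 1 / (1 + I)"
    using I \<open>p > 0\<close> by (simp only: s_def abs_of_nonneg[OF powr_ge_zero] powr_powr) (simp add: powr_minus_divide)
  then have "\<bar>s\<bar> powr p * I \<le> 1"
    using I by simp
  then have ball: "(\<lambda>x. s * f x) \<in> reproducing_ball p K"
    using f unfolding op_range_def I_def by (intro reproducing_ball_scaled) blast+
  have "continuous_on UNIV (\<lambda>x. s * f x)"
    unfolding continuous_on_iff
  proof (intro ballI allI impI)
    fix x e assume "e > (0::real)"
    then obtain d where "d > 0" "\<forall>f\<in>reproducing_ball p K. \<forall>x x'. dist x' x < d \<longrightarrow> \<bar>f x' - f x\<bar> \<le> e / 2"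
      using eq[of "e / 2"] by auto
    with ball \<open>e > 0\<close> show "\<exists>d>0. \<forall>x'\<in>UNIV. dist x' x < d \<longrightarrow> dist (s * f x') (s * f x) < e"
      by (intro exI[of _ d]) (fastforce simp: dist_real_def)
  qed
  then have "continuous_on UNIV (\<lambda>x. (1 / s) * (s * f x))"
    by (rule continuous_on_mult_left)
  moreover have "(\<lambda>x. (1 / s) * (s * f x)) = f"
    using s by simp
  ultimately show ?thesis by (simp only:)
qed

text \<open>All values lie in the compact interval [-B, B], on which t to |t|^p is uniformly
  continuous; composing the two moduli gives the claim.\<close>

lemma powr_abs_equicontinuous:
  fixes U :: "('a::metric_space \<Rightarrow> real) set"
  assumes p: "p > 0" and B: "\<And>f x. f \<in> U \<Longrightarrow> \<bar>f x\<bar> \<le> B"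
    and eq: "\<And>\<eta>. \<eta> > 0 \<Longrightarrow> \<exists>d>0. \<forall>f\<in>U. \<forall>x x'. dist x' x < d \<longrightarrow> \<bar>f x' - f x\<bar> \<le> \<eta>"
    and "\<eta> > 0"
  shows "\<exists>d>0. \<forall>f\<in>U. \<forall>x x'. dist x' x < d \<longrightarrow> \<bar>\<bar>f x'\<bar> powr p - \<bar>f x\<bar> powr p\<bar> \<le> \<eta>"
proof -
  have "uniformly_continuous_on {- B..B} (\<lambda>t :: real. \<bar>t\<bar> powr p)"
    by (intro compact_uniformly_continuous continuous_on_powr_abs p continuous_on_id) auto
  then obtain e where e: "e > 0"
    and he: "\<And>t t'. t \<in> {- B..B} \<Longrightarrow> t' \<in> {- B..B} \<Longrightarrow> dist t' t < e \<Longrightarrow> dist (\<bar>t'\<bar> powr p) (\<bar>t\<bar> powr p) < \<eta>"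
    using \<open>\<eta> > 0\<close> unfolding uniformly_continuous_on_def by metis
  obtain d where d: "d > 0" "\<And>f x x'. f \<in> U \<Longrightarrow> dist x' x < d \<Longrightarrow> \<bar>f x' - f x\<bar> \<le> e / 2"
    using eq[of "e / 2"] e by auto
  have "\<bar>\<bar>f x'\<bar> powr p - \<bar>f x\<bar> powr p\<bar> \<le> \<eta>" if "f \<in> U" "dist x' x < d" for f x x'
    using he[of "f x" "f x'"] B[OF that(1), of x] B[OF that(1), of x'] d(2)[OF that] e
    by (auto simp: dist_real_def abs_le_iff)
  with d(1) show ?thesis by blast
qed

section \<open>Averages over the cube, and from deviations to sampling bounds\<close>

lemma integral_uniform_cube:
  fixes h :: "real ^ 'n \<Rightarrow> real"
  assumes [measurable]: "h \<in> borel_measurable borel" and "R > 0"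
  shows "(LINT x|uniform_measure lborel (cube (R / 2)). h x) = (LINT x:cube (R / 2)|lebesgue. h x) / R ^ CARD('n)"
proof -
  have [measurable]: "cube s \<in> sets (borel :: (real^'n) measure)" for s
    by (simp add: cube_def)
  have E: "emeasure lborel (cube (R / 2) :: (real^'n) set) = ennreal (R ^ CARD('n))"
    using assms(2) by (subst emeasure_cube) auto
  have "(indicator (cube (R / 2)) x :: ennreal) / emeasure lborel (cube (R / 2) :: (real^'n) set)
      = ennreal (indicator (cube (R / 2)) x / R ^ CARD('n))" for x :: "real^'n"
    using assms(2) by (auto simp: E indicator_def divide_ennreal simp flip: ennreal_1)
  then have "(LINT x|uniform_measure lborel (cube (R / 2)). h x) =
      (LINT x|lborel. (indicator (cube (R / 2)) x / R ^ CARD('n)) *\<^sub>R h x)"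
    unfolding uniform_measure_def using assms(2) by (simp add: integral_density)
  also have "\<dots> = (LINT x|lborel. (indicator (cube (R / 2)) x *\<^sub>R h x) / R ^ CARD('n))"
    by simp
  also have "\<dots> = (LINT x|lborel. indicator (cube (R / 2)) x *\<^sub>R h x) / R ^ CARD('n)"
    by (rule integral_divide_zero)
  also have "(LINT x|lborel. indicator (cube (R / 2)) x *\<^sub>R h x) = (LINT x:cube (R / 2)|lebesgue. h x)"
    unfolding set_lebesgue_integral_def by (rule integral_completion[symmetric]) simp
  finally show ?thesis .
qed

lemma Lp_norm_powr_eq:
  assumes "1 \<le> p"
  shows "Lp_norm (ennreal p) f powr p = (LINT x|lebesgue. \<bar>f x\<bar> powr p)"
  using assms by (auto simp: Lp_norm_def powr_powr)

text \<open>Here I is the full integral of |f|^p, L its part over the cube, S the sample sum and q =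
  r / R^n. Concentration on the cube is used for the lower bound, and L \<le> I for the upper
  bound.\<close>

lemma sampling_bounds_of_deviation:
  fixes q \<delta> \<mu> I L S :: real
  assumes "q \<ge> 0" and L: "(1 - \<delta>) * I \<le> L" "L \<le> I" and dev: "\<bar>S - q * L\<bar> \<le> q * \<mu> * I"
  shows "q * (1 - \<mu> - \<delta>) * I \<le> S \<and> S \<le> q * (1 + \<mu>) * I"
proof -
  have "q * ((1 - \<delta>) * I) \<le> q * L" "q * L \<le> q * I"
    using L \<open>q \<ge> 0\<close> by (auto intro: mult_left_mono)
  moreover have "q * (1 - \<mu> - \<delta>) * I = q * ((1 - \<delta>) * I) - q * \<mu> * I"
    "q * (1 + \<mu>) * I = q * I + q * \<mu> * I"
    by (simp_all add: algebra_simps)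
  ultimately show ?thesis
    using dev by linarith
qed

theorem theorem1p1:
  fixes K :: "real ^ 'n \<Rightarrow> real ^ 'n \<Rightarrow> real"
    and p C \<alpha> R \<delta> \<mu> :: real
    and M :: "'w measure"
    and X :: "nat \<Rightarrow> 'w \<Rightarrow> real ^ 'n"
  assumes "1 \<le> p"
    and "(\<lambda>(x, y). K x y) \<in> borel_measurable lebesgue"
    and "\<And>x y. K x y = K y x"
    and "kernel_regular K"
    and "C > 0"
    and "ennreal \<alpha> > of_nat CARD('n) / conj_exponent p + of_nat CARD('n) + 1"
    and "kernel_decay C \<alpha> K"
    and "idempotent_on_Lp p K"
    and "R > 0"
    and "prob_space M"
    and "prob_space.indep_vars M (\<lambda>_. borel) X {1..}"
    and "\<And>j. j \<ge> 1 \<Longrightarrow> distr M borel (X j) = uniform_measure lborel (cube (R / 2))"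
    and "0 < \<mu>" and "\<mu> < 1 - \<delta>"
  shows "\<exists>a>0. \<exists>b>0. \<forall>r::nat\<ge>1.
    measure M {\<omega> \<in> space M. \<forall>f\<in>V_star p K R \<delta>.
        real r / R ^ CARD('n) * (1 - \<mu> - \<delta>) * Lp_norm (ennreal p) f powr p
          \<le> (\<Sum>j=1..r. \<bar>f (X j \<omega>)\<bar> powr p) \<and>
        (\<Sum>j=1..r. \<bar>f (X j \<omega>)\<bar> powr p)
          \<le> real r / R ^ CARD('n) * (1 + \<mu>) * Lp_norm (ennreal p) f powr p}
    \<ge> 1 - 2 * a * exp (- (b / (p * kernel_sup_pow p K R * R ^ CARD('n)))
                        * (real r * \<mu>\<^sup>2 / (12 + \<mu>)))"
proof -
  interpret prob_space M by fact
  let ?n = "CARD('n)" and ?k = "kernel_sup_pow p K R"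
  let ?D = "uniform_measure lborel (cube (R / 2)) :: (real^'n) measure"
  let ?I = "\<lambda>f :: real^'n \<Rightarrow> real. LINT x|lebesgue. \<bar>f x\<bar> powr p"
  define good where "good r = {\<omega> \<in> space M. \<forall>f\<in>V_star p K R \<delta>.
        real r / R ^ ?n * (1 - \<mu> - \<delta>) * Lp_norm (ennreal p) f powr p
          \<le> (\<Sum>j=1..r. \<bar>f (X j \<omega>)\<bar> powr p) \<and>
        (\<Sum>j=1..r. \<bar>f (X j \<omega>)\<bar> powr p)
          \<le> real r / R ^ ?n * (1 + \<mu>) * Lp_norm (ennreal p) f powr p}" for r :: nat
  have p: "1 \<le> p" "p > 0" using assms(1) by auto
  have Rn: "R ^ ?n > 0" using \<open>R > 0\<close> by simp
  have \<alpha>: "\<alpha> > real ?n + 1"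
  \<comment> \<open>The term n/p' is nonnegative, so the assumption on \<alpha> contains this bound.
    The comparison is made in \<open>ennreal\<close>, where p' = \<infinity> is covered too.\<close>
  proof -
    have "ennreal (real ?n + 1) = of_nat ?n + 1"
      by (subst ennreal_plus) (auto simp: ennreal_of_nat_eq_real_of_nat)
    also have "\<dots> \<le> of_nat ?n / conj_exponent p + of_nat ?n + 1"
      by (simp add: add.assoc add_increasing)
    also note assms(6)
    finally show ?thesis by (subst (asm) ennreal_less_iff) auto
  qed
  obtain B where "B > 0" and B: "\<And>f x. f \<in> reproducing_ball p K \<Longrightarrow> \<bar>f x\<bar> \<le> B"
    and eq: "\<And>\<eta>. \<eta> > 0 \<Longrightarrow>
      \<exists>d>0. \<forall>f\<in>reproducing_ball p K. \<forall>x x'. dist x' x < d \<longrightarrow> \<bar>f x' - f x\<bar> \<le> \<eta>"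
    by (rule reproducing_ball_equicontinuous[OF assms(2,4,7,5) \<alpha> p(1)]) (rule that)
  have X: "random_variable borel (X j)" if "j \<ge> 1" for j
    using assms(11) that by (auto simp: indep_vars_def)
  have cont: "continuous_on UNIV (\<lambda>x. \<bar>f x\<bar> powr p)" if "f \<in> op_range p K" for f
    using op_range_continuous[OF eq that p(2)] p(2) by (rule continuous_on_powr_abs)
  have V: "V_star p K R \<delta> \<subseteq> op_range p K"
    by (auto simp: V_star_def)
  have good_meas: "good r \<in> events" for r
    unfolding good_def using V by (intro sets_all_sum_bounds[OF X] cont) auto
  define F where "F = (\<lambda>f x. \<bar>f x\<bar> powr p) ` reproducing_ball p K"
  have ball_cont: "continuous_on UNIV f" if "f \<in> reproducing_ball p K" for f
    using that by (intro op_range_continuous[OF eq _ p(2)])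
      (auto simp: reproducing_ball_def op_range_def)
  obtain A c where "A > 0" "c > 0"
    and G: "\<And>r::nat. r \<ge> 1 \<Longrightarrow> \<exists>G\<in>events. prob G \<ge> 1 - A * exp (- (c * real r)) \<and>
      (\<forall>\<omega>\<in>G. \<forall>f\<in>F. \<bar>(\<Sum>j=1..r. f (X j \<omega>)) - real r * (LINT x|?D. f x)\<bar> \<le> real r * (\<mu> / R ^ ?n))"
  \<comment> \<open>The uniform density on the cube is 1 / R^n, so tolerance \<mu> / R^n is the
    scale of the sampling inequality. The functions |f|^p are bounded by B^p.\<close>
  proof (rule uniform_Hoeffding[OF assms(11,12), of "cube (R / 2)" F "B powr p" "\<mu> / R ^ ?n"])
    have "emeasure lborel (cube (R / 2) :: (real^'n) set) = ennreal (R ^ ?n)"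
      using \<open>R > 0\<close> by (subst emeasure_cube) auto
    then show "AE x in ?D. x \<in> cube (R / 2)"
      using Rn \<open>R > 0\<close> by (subst AE_uniform_measure) auto
    show "F \<subseteq> borel_measurable borel"
      unfolding F_def
      by (intro image_subsetI borel_measurable_continuous_onI continuous_on_powr_abs p(2)) (rule ball_cont)
    show "\<bar>f x\<bar> \<le> B powr p" if "f \<in> F" for f x
      using that B p by (auto simp: F_def intro!: powr_mono2)
    show "\<exists>d>0. \<forall>f\<in>F. \<forall>x\<in>cube (R / 2). \<forall>x'\<in>cube (R / 2). dist x' x < d \<longrightarrow> \<bar>f x' - f x\<bar> \<le> \<eta>"
      if "\<eta> > 0" for \<eta>
    proof -
      have "\<exists>d>0. \<forall>f\<in>reproducing_ball p K. \<forall>x x'. dist x' x < d \<longrightarrow> \<bar>\<bar>f x'\<bar> powr p - \<bar>f x\<bar> powr p\<bar> \<le> \<eta>"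
        using p(2) B eq that by (rule powr_abs_equicontinuous)
      then show ?thesis
        unfolding F_def by blast
    qed
  qed (use \<open>B > 0\<close> \<open>\<mu> > 0\<close> Rn that in \<open>auto simp: compact_cube\<close>)
  have sampling: "\<omega> \<in> good r"
    if r: "r \<ge> 1" and \<omega>: "\<omega> \<in> space M"
      and dev: "\<forall>f\<in>F. \<bar>(\<Sum>j=1..r. f (X j \<omega>)) - real r * (LINT x|?D. f x)\<bar> \<le> real r * (\<mu> / R ^ ?n)"
    for \<omega> and r :: nat
    unfolding good_def
  proof (intro CollectI conjI[OF \<omega>] ballI)
    fix f assume f: "f \<in> V_star p K R \<delta>"
    have fL: "f \<in> Lp_space p" and rep: "\<And>x. f x = kernel_op K f x" and fV: "f \<in> op_range p K"
      using f by (auto simp: V_star_def op_range_def)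
    have fi: "integrable lebesgue (\<lambda>x. \<bar>f x\<bar> powr p)"
      using fL by (auto simp: Lp_space_def)
    define L where "L = (LINT x:cube (R / 2)|lebesgue. \<bar>f x\<bar> powr p)"
    define S where "S = (\<Sum>j=1..r. \<bar>f (X j \<omega>)\<bar> powr p)"
    have L1: "(1 - \<delta>) * ?I f \<le> L"
      using f p(1) by (simp add: V_star_def L_def Lp_norm_powr_eq)
    have L2: "L \<le> ?I f"
      unfolding L_def set_lebesgue_integral_def
      by (intro integral_mono integrable_mult_indicator fi) (auto simp: cube_def indicator_def)
    have "real r / R ^ ?n * (1 - \<mu> - \<delta>) * ?I f \<le> S \<and> S \<le> real r / R ^ ?n * (1 + \<mu>) * ?I f"
    proof (cases "?I f = 0")
      case True
      then have "AE x in lebesgue. \<bar>f x\<bar> powr p = 0"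
        using fi by (subst (asm) integral_nonneg_eq_0_iff_AE) auto
      \<comment> \<open>Vanishing almost everywhere becomes vanishing everywhere through f = Tf, so
        the sample values are 0 too.\<close>
      then have "f x = 0" for x
        unfolding rep[of x] kernel_op_def by (intro integral_eq_zero_AE) (auto elim!: eventually_mono)
      then show ?thesis
        using True by (simp add: S_def)
    next
      case False
      moreover have "?I f \<ge> 0"
        by (rule Bochner_Integration.integral_nonneg) simp
      ultimately have I: "?I f > 0"
        by linarith
      define s where "s = ?I f powr (- (1 / p))"
      have sp: "\<bar>s\<bar> powr p = 1 / ?I f"
        using I p by (simp only: s_def abs_of_nonneg[OF powr_ge_zero] powr_powr) (simp add: powr_minus_divide)
      have "(\<lambda>x. s * f x) \<in> reproducing_ball p K"
        using I by (intro reproducing_ball_scaled fL rep) (simp add: sp)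
      then have "(\<lambda>x. \<bar>s * f x\<bar> powr p) \<in> F"
        by (auto simp: F_def)
      moreover have "\<bar>s * f x\<bar> powr p = \<bar>f x\<bar> powr p / ?I f" for x
        by (simp add: abs_mult powr_mult sp)
      ultimately have "(\<lambda>x. \<bar>f x\<bar> powr p / ?I f) \<in> F"
        by simp
      \<comment> \<open>The deviation bound holds for the normalised function; multiplying by the
        integral of |f|^p below restores homogeneity.\<close>
      from dev[rule_format, OF this]
      have "\<bar>S / ?I f - real r * ((LINT x|?D. \<bar>f x\<bar> powr p) / ?I f)\<bar> \<le> real r * (\<mu> / R ^ ?n)"
        by (simp add: S_def sum_divide_distrib)
      also have "(LINT x|?D. \<bar>f x\<bar> powr p) = L / R ^ ?n"
        unfolding L_def using cont[OF fV] \<open>R > 0\<close>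
        by (intro integral_uniform_cube borel_measurable_continuous_onI)
      finally have "\<bar>S / ?I f - real r * (L / R ^ ?n / ?I f)\<bar> * ?I f \<le> real r * (\<mu> / R ^ ?n) * ?I f"
        using I by (intro mult_right_mono) auto
      moreover have "\<bar>S / ?I f - real r * (L / R ^ ?n / ?I f)\<bar> * ?I f
          = \<bar>(S / ?I f - real r * (L / R ^ ?n / ?I f)) * ?I f\<bar>"
        using I by (simp add: abs_mult)
      moreover have "(S / ?I f - real r * (L / R ^ ?n / ?I f)) * ?I f = S - real r / R ^ ?n * L"
        using I by (simp add: left_diff_distrib)
      ultimately have dev': "\<bar>S - real r / R ^ ?n * L\<bar> \<le> real r / R ^ ?n * \<mu> * ?I f"
        by simp
      show ?thesis
        by (rule sampling_bounds_of_deviation[OF _ L1 L2 dev']) (use Rn in simp)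
    qed
    then show "real r / R ^ ?n * (1 - \<mu> - \<delta>) * Lp_norm (ennreal p) f powr p
          \<le> (\<Sum>j=1..r. \<bar>f (X j \<omega>)\<bar> powr p) \<and>
        (\<Sum>j=1..r. \<bar>f (X j \<omega>)\<bar> powr p)
          \<le> real r / R ^ ?n * (1 + \<mu>) * Lp_norm (ennreal p) f powr p"
      using p(1) by (simp add: Lp_norm_powr_eq S_def)
  qed
  have main: "prob (good r) \<ge> 1 - A * exp (- (c * real r))" if r: "r \<ge> 1" for r
  proof -
    obtain G where "G \<in> events" "prob G \<ge> 1 - A * exp (- (c * real r))"
      "\<forall>\<omega>\<in>G. \<forall>f\<in>F. \<bar>(\<Sum>j=1..r. f (X j \<omega>)) - real r * (LINT x|?D. f x)\<bar> \<le> real r * (\<mu> / R ^ ?n)"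
      using G[OF r] by blast
    moreover from this have "G \<subseteq> good r"
      using sampling[OF r] sets.sets_into_space by blast
    ultimately show ?thesis
      using finite_measure_mono[OF _ good_meas] by (meson order_trans)
  qed
  have "\<exists>a>0. \<exists>b>0. \<forall>r::nat\<ge>1.
      1 - 2 * a * exp (- (b / (p * ?k * R ^ ?n)) * (real r * \<mu>\<^sup>2 / (12 + \<mu>))) \<le> prob (good r)"
  proof (cases "?k = 0")
    case True
    \<comment> \<open>The exponent is then 0, as division by 0 gives 0, and the claim is trivial.\<close>
    have "1 - 2 * 1 * exp (- (1 / (p * ?k * R ^ ?n)) * (real r * \<mu>\<^sup>2 / (12 + \<mu>))) \<le> prob (good r)" for r
    proof -
      have "- 1 \<le> prob (good r)"
        by (rule order_trans[OF _ measure_nonneg]) simp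
      then show ?thesis by (simp add: True)
    qed
    then show ?thesis
      by (intro exI[of _ 1] conjI allI impI zero_less_one)
  next
    case False
    then have k: "?k > 0"
      by (auto simp: kernel_sup_pow_def split: if_splits)
    \<comment> \<open>This value makes the exponent in the claim exactly -c r. Similarly a = A/2
      below absorbs the factor 2 in front of the exponential.\<close>
    define b where "b = c * (12 + \<mu>) / \<mu>\<^sup>2 * (p * ?k * R ^ ?n)"
    have b: "b > 0"
      using k \<open>c > 0\<close> \<open>\<mu> > 0\<close> p Rn by (simp add: b_def)
    have b_eq: "b / (p * ?k * R ^ ?n) = c * (12 + \<mu>) / \<mu>\<^sup>2"
      using k p \<open>R > 0\<close> by (simp add: b_def)
    have e: "- (b / (p * ?k * R ^ ?n)) * (real r * \<mu>\<^sup>2 / (12 + \<mu>)) = - (c * real r)" for r :: nat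
      unfolding b_eq using \<open>\<mu> > 0\<close> by simp
    show ?thesis
      using main \<open>A > 0\<close> b by (intro exI[of _ "A / 2"] exI[of _ b] conjI allI impI) (simp_all only: e, simp_all)
  qed
  then show ?thesis
    unfolding good_def .
qed

end
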